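(* Let $n \geq 5$ and $k \geq 2$ be integers with $k < n/2$, and let $\pi = (d_1 \leq \cdots \leq d_n)$ be a graphical sequence such that $d_1 = \cdots = d_k = k$ and $d_{k+1} = \cdots = d_{n-k+1} = n-k-1$. Then $\pi$ is forcibly hamiltonian unless $d_j = n-k-1$ for all $j$ with $n-k+2 \leq j \leq n-1$ and $d_n = n-1$.
   Context: A sequence of nonnegative integers is graphical if it is the degree sequence of some finite simple graph. A graphical sequence $\pi$ is forcibly hamiltonian if every simple graph with degree sequence $\pi$ is hamiltonian (has a cycle through all vertices). *)

theory Defs
  imports "Graph_Theory.Graph_Theory"
begin

text \<open>
  A finite simple graph is a \<^locale>\<open>pair_graph\<close>: a finite, loop-free digraph with symmetric
  arc relation, an undirected edge \<open>uv\<close> being the pair of arcs \<open>(u,v)\<close>, \<open>(v,u)\<close>. The degree of a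
  vertex is therefore its out-degree. A sequence \<open>d\<^sub>1, \<dots>, d\<^sub>n\<close> is a function \<open>d\<close>, of which only the
  values on \<open>{1..n}\<close> matter.
\<close>

definition has_degree_sequence :: "'a pair_pre_digraph \<Rightarrow> nat \<Rightarrow> (nat \<Rightarrow> nat) \<Rightarrow> bool" where
  "has_degree_sequence G n d \<longleftrightarrow>
     (\<exists>v. bij_betw v {1..n} (pverts G) \<and> (\<forall>i\<in>{1..n}. out_degree (with_proj G) (v i) = d i))"

text \<open>
  The bound on the length excludes the closed walks \<open>(u,v), (v,u)\<close>, which are cycles of the
  symmetric digraph but not of the undirected graph. The vertices of a cycle are the tails of
  its arcs.
\<close>

definition hamiltonian :: "'a pair_pre_digraph \<Rightarrow> bool" where
  "hamiltonian G \<longleftrightarrow>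
     (\<exists>p. pre_digraph.cycle (with_proj G) p \<and> 3 \<le> length p \<and> fst ` set p = pverts G)"

text \<open>
  Every finite graph is isomorphic to one with vertices in \<^typ>\<open>nat\<close>, so this type suffices for
  the existential quantifier.
\<close>

definition graphical :: "nat \<Rightarrow> (nat \<Rightarrow> nat) \<Rightarrow> bool" where
  "graphical n d \<longleftrightarrow> (\<exists>G :: nat pair_pre_digraph. pair_graph G \<and> has_degree_sequence G n d)"

text \<open>
  The type argument is the type of vertices over which the realizations range; a theorem with a
  free type variable here covers graphs over every vertex type.
\<close>

definition forcibly_hamiltonian :: "'a itself \<Rightarrow> nat \<Rightarrow> (nat \<Rightarrow> nat) \<Rightarrow> bool" where
  "forcibly_hamiltonian (T :: 'a itself) n d \<longleftrightarrow>
     graphical n d \<and>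
     (\<forall>G :: 'a pair_pre_digraph. pair_graph G \<and> has_degree_sequence G n d \<longrightarrow> hamiltonian G)"

end

theory Submission
  imports Defs
begin

text \<open>
  Let \<open>G\<close> be a nonhamiltonian realization, \<open>S\<close> a set of \<open>k\<close> vertices of degree \<open>k\<close>, and \<open>F\<close> an
  edge-maximal nonhamiltonian supergraph of \<open>G\<close>. By Ore's argument two vertices whose degrees in
  \<open>F\<close> sum to at least \<open>n\<close> are adjacent in \<open>F\<close>.

  If \<open>n \<ge> 2k + 2\<close>, the complement of \<open>S\<close> is a clique of \<open>F\<close>, and each of its vertices is joined
  either to all of \<open>S\<close> or to none of it; let \<open>T\<close> be the set of the former. All vertices of \<open>S\<close> keep
  degree \<open>k\<close> in \<open>F\<close>, since otherwise \<open>F\<close> would be complete; hence \<open>1 \<le> |T| \<le> k\<close>. If \<open>|T| = k\<close>,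
  then \<open>G\<close> has \<open>k\<close> vertices of degree at least \<open>n - k\<close>, too many. If \<open>2 \<le> |T| < k\<close>, then Dirac's
  theorem gives a Hamiltonian cycle of \<open>S\<close> together with all but one vertex of \<open>T\<close>; it extends
  through the remaining clique to one of \<open>F\<close>. So \<open>|T| = 1\<close>, which is the excluded sequence.

  If \<open>n = 2k + 1\<close>, a Hamiltonian path of \<open>F\<close> with nonadjacent ends shows that \<open>G\<close> has an
  independent set of size \<open>k + 1\<close>, again forcing \<open>k\<close> vertices of degree above \<open>k\<close>, or a cut
  vertex that separates two sets of size \<open>k\<close>, which is the excluded sequence.
\<close>

section \<open>Paths and cycles as vertex lists\<close>

abbreviation deg :: "('a \<times> 'a) set \<Rightarrow> 'a \<Rightarrow> nat" where
  "deg E v \<equiv> card (E `` {v})"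

text \<open>Paths are vertex lists so that exchange arguments become cutting, reversing and rotating
  of lists; \<open>has_ham_cycle_imp_hamiltonian\<close> returns to lists of arcs.\<close>

definition path_list :: "('a \<times> 'a) set \<Rightarrow> 'a list \<Rightarrow> bool" where
  "path_list E xs \<longleftrightarrow> distinct xs \<and> successively (\<lambda>u v. (u, v) \<in> E) xs"

definition cycle_list :: "('a \<times> 'a) set \<Rightarrow> 'a list \<Rightarrow> bool" where
  "cycle_list E xs \<longleftrightarrow> path_list E xs \<and> 3 \<le> length xs \<and> (last xs, hd xs) \<in> E"

definition has_ham_cycle :: "'a set \<Rightarrow> ('a \<times> 'a) set \<Rightarrow> bool" where
  "has_ham_cycle V E \<longleftrightarrow> (\<exists>xs. cycle_list E xs \<and> set xs = V)"

lemma path_list_Cons: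
  "path_list E (x # xs) \<longleftrightarrow> x \<notin> set xs \<and> path_list E xs \<and> (xs = [] \<or> (x, hd xs) \<in> E)"
  by (auto simp: path_list_def successively_Cons)

lemma path_list_append_iff:
  "path_list E (xs @ ys) \<longleftrightarrow> path_list E xs \<and> path_list E ys \<and> set xs \<inter> set ys = {} \<and>
     (xs = [] \<or> ys = [] \<or> (last xs, hd ys) \<in> E)"
  by (auto simp: path_list_def successively_append_iff)

lemma path_list_mono: "path_list E xs \<Longrightarrow> E \<subseteq> F \<Longrightarrow> path_list F xs"
  by (auto simp: path_list_def elim!: successively_mono)

lemma path_list_rev: "sym E \<Longrightarrow> path_list E (rev xs) \<longleftrightarrow> path_list E xs"
  by (auto simp: path_list_def sym_def elim!: successively_mono)

lemma cycle_list_rotate: "cycle_list E (xs @ ys) \<Longrightarrow> cycle_list E (ys @ xs)"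
  by (cases "xs = []"; cases "ys = []") (auto simp: cycle_list_def path_list_append_iff)

lemma clique_path_list:
  assumes "distinct xs" "\<And>u v. u \<in> set xs \<Longrightarrow> v \<in> set xs \<Longrightarrow> u \<noteq> v \<Longrightarrow> (u, v) \<in> E"
  shows "path_list E xs"
proof -
  have "(xs ! i, xs ! Suc i) \<in> E" if "Suc i < length xs" for i
    using assms that by (auto simp: nth_eq_iff_index_eq)
  with assms(1) show ?thesis
    by (simp add: path_list_def successively_conv_nth)
qed

section \<open>Simple graphs and the ends of Hamiltonian paths\<close>

locale simple_graph =
  fixes V :: "'a set" and E :: "('a \<times> 'a) set"
  assumes finite_V: "finite V"
    and E_subset: "E \<subseteq> V \<times> V"
    and sym_E: "sym E"
    and irrefl_E: "irrefl E"
begin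

lemma nbrs_subset: "E `` {v} \<subseteq> V"
  using E_subset by auto

lemma finite_nbrs [simp, intro]: "finite (E `` {v})"
  using finite_subset[OF nbrs_subset finite_V] .

lemma E_sym: "(u, v) \<in> E \<longleftrightarrow> (v, u) \<in> E"
  using sym_E by (auto simp: sym_def)

lemma not_loop [simp]: "(v, v) \<notin> E"
  using irrefl_E by (auto simp: irrefl_def)

lemma deg_le_card: "E `` {v} \<subseteq> A \<Longrightarrow> finite A \<Longrightarrow> deg E v \<le> card A"
  by (rule card_mono)

lemma card_le_deg: "A \<subseteq> E `` {v} \<Longrightarrow> card A \<le> deg E v"
  by (rule card_mono) auto

lemma clique_has_ham_cycle:
  assumes "3 \<le> card V" "\<And>u v. u \<in> V \<Longrightarrow> v \<in> V \<Longrightarrow> u \<noteq> v \<Longrightarrow> (u, v) \<in> E"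
  shows "has_ham_cycle V E"
proof -
  obtain xs where xs: "distinct xs" "set xs = V"
    using finite_V finite_distinct_list by blast
  have "length xs = card V" using xs distinct_card by fastforce
  moreover have "path_list E xs"
    using xs assms by (auto intro: clique_path_list)
  moreover have "(last xs, hd xs) \<in> E"
  proof -
    have ne: "xs \<noteq> []" using assms(1) \<open>length xs = card V\<close> by auto
    moreover have "last xs \<noteq> hd xs"
      using xs(1) assms(1) \<open>length xs = card V\<close> ne
      by (simp add: last_conv_nth hd_conv_nth nth_eq_iff_index_eq)
    ultimately show ?thesis using assms(2) xs(2) by (metis hd_in_set last_in_set)
  qed
  ultimately show ?thesis
    using assms(1) xs(2) unfolding has_ham_cycle_def cycle_list_def by auto
qed

text \<open>The cycle is \<open>xs @ rev ys\<close>: along \<open>xs\<close>, over a chord to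
  \<open>last ys\<close>, back along \<open>ys\<close>, and over the other chord from
  \<open>hd ys\<close> to \<open>hd xs\<close>.\<close>

lemma crossing_chords_has_ham_cycle:
  assumes "path_list E (xs @ ys)" "xs \<noteq> []" "ys \<noteq> []" "set (xs @ ys) = V" "3 \<le> card V"
    and "(hd xs, hd ys) \<in> E" "(last ys, last xs) \<in> E"
  shows "has_ham_cycle V E"
proof -
  have "length (xs @ ys) = card V"
    using assms(1,4) by (metis distinct_card path_list_def)
  then have "cycle_list E (xs @ rev ys)"
    using assms E_sym
    by (auto simp: cycle_list_def path_list_append_iff path_list_rev[OF sym_E] hd_rev last_rev)
  then show ?thesis using assms(4) unfolding has_ham_cycle_def by (intro exI) auto
qed

lemma ham_path_chords:
  assumes "\<not> has_ham_cycle V E" "3 \<le> card V" "path_list E xs" "set xs = V"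
    and "Suc i < card V" "(hd xs, xs ! Suc i) \<in> E"
  shows "(last xs, xs ! i) \<notin> E"
proof
  assume *: "(last xs, xs ! i) \<in> E"
  have l: "length xs = card V" using assms(3,4) by (metis distinct_card path_list_def)
  have "has_ham_cycle V E"
  proof (rule crossing_chords_has_ham_cycle)
    show "path_list E (take (Suc i) xs @ drop (Suc i) xs)" using assms by simp
    show "(hd (take (Suc i) xs), hd (drop (Suc i) xs)) \<in> E"
      using assms l by (simp add: hd_drop_conv_nth)
    show "(last (drop (Suc i) xs), last (take (Suc i) xs)) \<in> E"
      using * assms l by (simp add: last_drop take_Suc_conv_app_nth)
  qed (use assms l in auto)
  with assms show False by simp
qed

lemma card_nbr_indices:
  assumes "distinct xs" "E `` {v} \<subseteq> set xs"
  shows "card {i. i < length xs \<and> (v, xs ! i) \<in> E} = deg E v" (is "card ?A = _")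
proof -
  have "bij_betw (\<lambda>i. xs ! i) ?A (E `` {v})"
  proof (rule bij_betw_imageI)
    show "inj_on (\<lambda>i. xs ! i) ?A"
      using assms(1) by (auto simp: inj_on_def nth_eq_iff_index_eq)
    show "(!) xs ` ?A = E `` {v}"
      using assms(2) by (auto simp: in_set_conv_nth image_iff subset_iff)
  qed
  then show ?thesis by (rule bij_betw_same_card)
qed

text \<open>Ore's counting. \<open>A\<close> holds the positions just before neighbours of
  \<open>hd xs\<close>, \<open>B\<close> the positions of neighbours of \<open>last xs\<close>. Both
  lie among the first \<open>card V - 1\<close> positions, and they are disjoint because a common
  position would give crossing chords. If the degree sum attains the bound, they partition these
  positions.\<close>

lemma
  assumes nh: "\<not> has_ham_cycle V E" and V3: "3 \<le> card V" and xs: "path_list E xs" "set xs = V"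
  shows ham_path_deg_sum: "deg E (hd xs) + deg E (last xs) \<le> card V - 1"
    and ham_path_dichotomy:
      "card V - 1 \<le> deg E (hd xs) + deg E (last xs) \<Longrightarrow> Suc i < card V \<Longrightarrow>
       (hd xs, xs ! Suc i) \<in> E \<longleftrightarrow> (last xs, xs ! i) \<notin> E"
proof -
  let ?n = "card V"
  have d: "distinct xs" using xs by (simp add: path_list_def)
  have l: "length xs = ?n" using d xs by (metis distinct_card)
  then have ne: "xs \<noteq> []" using V3 by auto
  define A where "A = {i. Suc i < ?n \<and> (hd xs, xs ! Suc i) \<in> E}"
  define B where "B = {i. i < ?n \<and> (last xs, xs ! i) \<in> E}"
  have "Suc ` A = {i. i < ?n \<and> (hd xs, xs ! i) \<in> E}" (is "_ = ?A")
  proof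
    show "?A \<subseteq> Suc ` A"
    proof
      fix i assume "i \<in> ?A"
      moreover from this have "i \<noteq> 0" using ne by (metis (no_types, lifting) hd_conv_nth mem_Collect_eq not_loop)
      ultimately show "i \<in> Suc ` A" by (cases i) (auto simp: A_def)
    qed
  qed (auto simp: A_def)
  then have cA: "card A = deg E (hd xs)"
    using card_nbr_indices[OF d] nbrs_subset xs(2) l card_image[of Suc A] by simp
  have cB: "card B = deg E (last xs)"
    using card_nbr_indices[OF d] nbrs_subset xs(2) l by (simp add: B_def)
  have "B \<subseteq> {..<?n - 1}"
  proof
    fix i assume "i \<in> B"
    moreover have "i \<noteq> ?n - 1" if "i \<in> B"
      using that l ne by (auto simp: B_def last_conv_nth)
    ultimately show "i \<in> {..<?n - 1}" by (auto simp: B_def)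
  qed
  moreover have "A \<subseteq> {..<?n - 1}" by (auto simp: A_def)
  ultimately have sub: "A \<union> B \<subseteq> {..<?n - 1}" by simp
  have fin: "finite A" "finite B" using sub by (auto intro: finite_subset)
  have "A \<inter> B = {}"
    using ham_path_chords[OF nh V3 xs] by (auto simp: A_def B_def)
  then have sum: "card (A \<union> B) = deg E (hd xs) + deg E (last xs)"
    using fin cA cB by (simp add: card_Un_disjoint)
  show "deg E (hd xs) + deg E (last xs) \<le> ?n - 1"
    using card_mono[OF _ sub] sum by simp
  assume "?n - 1 \<le> deg E (hd xs) + deg E (last xs)" and i: "Suc i < ?n"
  then have "A \<union> B = {..<?n - 1}"
    using sub sum by (intro card_seteq) auto
  then have "i \<in> A \<union> B" using i by auto
  then show "(hd xs, xs ! Suc i) \<in> E \<longleftrightarrow> (last xs, xs ! i) \<notin> E"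
    using i ham_path_chords[OF nh V3 xs i] by (auto simp: A_def B_def)
qed

end

section \<open>Edge-maximal nonhamiltonian graphs and Dirac's theorem\<close>

locale maximal_nonham_graph = simple_graph +
  assumes nonham: "\<not> has_ham_cycle V E"
    and maximal: "\<And>u v. u \<in> V \<Longrightarrow> v \<in> V \<Longrightarrow> u \<noteq> v \<Longrightarrow> (u, v) \<notin> E \<Longrightarrow>
      has_ham_cycle V (insert (u, v) (insert (v, u) E))"
begin

text \<open>A Hamiltonian cycle created by adding the edge \<open>uv\<close> must use it. Rotated so
  that \<open>uv\<close> is the closing edge, its vertex list is a path in the original
  graph.\<close>

lemma nonadjacent_ham_path:
  assumes "u \<in> V" "v \<in> V" "u \<noteq> v" "(u, v) \<notin> E"
  obtains xs where "path_list E xs" "set xs = V" "hd xs = u" "last xs = v"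
proof -
  let ?F = "insert (u, v) (insert (v, u) E)"
  obtain xs where xs: "cycle_list ?F xs" "set xs = V"
    using maximal[OF assms] by (auto simp: has_ham_cycle_def)
  have "\<exists>ys. cycle_list ?F ys \<and> set ys = V \<and> (last ys, hd ys) \<in> {(u, v), (v, u)}"
  proof (cases "path_list E xs")
    case True
    then have "(last xs, hd xs) \<in> {(u, v), (v, u)}"
      using xs nonham by (auto simp: has_ham_cycle_def cycle_list_def)
    then show ?thesis using xs by auto
  next
    case False
    then obtain i where i: "Suc i < length xs" "(xs ! i, xs ! Suc i) \<notin> E"
      using xs by (auto simp: path_list_def cycle_list_def successively_conv_nth)
    moreover have "(xs ! i, xs ! Suc i) \<in> ?F"
      using xs i(1) by (simp only: path_list_def cycle_list_def successively_conv_nth)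
    ultimately have "(xs ! i, xs ! Suc i) \<in> {(u, v), (v, u)}" by simp
    moreover have "cycle_list ?F (drop (Suc i) xs @ take (Suc i) xs)"
      using xs cycle_list_rotate[of ?F "take (Suc i) xs" "drop (Suc i) xs"] by simp
    moreover have "set (drop (Suc i) xs @ take (Suc i) xs) = V"
      using xs(2) by (metis Un_commute append_take_drop_id set_append)
    ultimately show ?thesis using i(1)
      by (intro exI[of _ "drop (Suc i) xs @ take (Suc i) xs"])
         (simp add: hd_drop_conv_nth take_Suc_conv_app_nth)
  qed
  then obtain ys where ys: "cycle_list ?F ys" "set ys = V" "(last ys, hd ys) \<in> {(u, v), (v, u)}"
    by blast
  have d: "distinct ys" "3 \<le> length ys" using ys by (auto simp: cycle_list_def path_list_def)
  have ne: "ys \<noteq> []" using d by auto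
  have "path_list E ys"
    unfolding path_list_def successively_conv_nth
  proof (intro conjI allI impI d)
    fix i assume i: "Suc i < length ys"
    then have "(ys ! i, ys ! Suc i) \<in> ?F"
      using ys(1) by (simp only: path_list_def cycle_list_def successively_conv_nth)
    \<comment> \<open>The edge \<open>uv\<close> already joins the last vertex to the first, and in
      a list of at least three distinct vertices these are not consecutive.\<close>
    moreover have "(ys ! i, ys ! Suc i) \<notin> {(u, v), (v, u)}"
    proof
      assume "(ys ! i, ys ! Suc i) \<in> {(u, v), (v, u)}"
      then have "{ys ! i, ys ! Suc i} = {ys ! (length ys - 1), ys ! 0}"
        using ys(3) ne by (auto simp: last_conv_nth hd_conv_nth)
      then have "(i = 0 \<or> Suc i = 0) \<and> (i = length ys - 1 \<or> Suc i = length ys - 1)"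
        using d i ne by (auto simp: doubleton_eq_iff nth_eq_iff_index_eq)
      then show False using d(2) by auto
    qed
    ultimately show "(ys ! i, ys ! Suc i) \<in> E" by blast
  qed
  then show thesis
    using ys(2,3) that[of ys] that[of "rev ys"]
    by (auto simp: path_list_rev[OF sym_E] hd_rev last_rev)
qed

lemma adjacent_if_deg_sum:
  assumes "u \<in> V" "v \<in> V" "u \<noteq> v" "card V \<le> deg E u + deg E v" "3 \<le> card V"
  shows "(u, v) \<in> E"
proof (rule ccontr)
  assume "(u, v) \<notin> E"
  then obtain xs where "path_list E xs" "set xs = V" "hd xs = u" "last xs = v"
    using assms nonadjacent_ham_path by blast
  then show False
    using ham_path_deg_sum[OF nonham assms(5)] assms by fastforce
qed

end

lemma (in simple_graph) maximal_nonham_supergraph: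
  assumes "\<not> has_ham_cycle V E"
  obtains F where "E \<subseteq> F" "maximal_nonham_graph V F"
proof -
  define \<F> where "\<F> = {F. E \<subseteq> F \<and> simple_graph V F \<and> \<not> has_ham_cycle V F}"
  have "\<F> \<subseteq> Pow (V \<times> V)"
    by (auto simp: \<F>_def dest: simple_graph.E_subset)
  then have "finite \<F>" using finite_V by (auto intro: finite_subset)
  moreover have "E \<in> \<F>" using assms simple_graph_axioms by (auto simp: \<F>_def)
  ultimately obtain F where F: "F \<in> \<F>" "\<And>F'. F' \<in> \<F> \<Longrightarrow> F \<subseteq> F' \<Longrightarrow> F = F'"
    using finite_has_maximal[of \<F>] by blast
  have sg: "simple_graph V F" using F by (simp add: \<F>_def)
  have "has_ham_cycle V (insert (u, v) (insert (v, u) F))"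
    if "u \<in> V" "v \<in> V" "u \<noteq> v" "(u, v) \<notin> F" for u v
  proof (rule ccontr)
    assume "\<not> ?thesis"
    moreover have "simple_graph V (insert (u, v) (insert (v, u) F))"
      using sg that by (auto simp: simple_graph_def sym_def irrefl_def)
    ultimately have "insert (u, v) (insert (v, u) F) \<in> \<F>"
      using F(1) by (auto simp: \<F>_def)
    with F(2) that(4) show False by blast
  qed
  then have "maximal_nonham_graph V F"
    using F(1) by (auto simp: \<F>_def maximal_nonham_graph_def maximal_nonham_graph_axioms_def)
  with F(1) show thesis by (intro that) (auto simp: \<F>_def)
qed

text \<open>Degrees only grow in an edge-maximal nonhamiltonian supergraph, so Ore's argument makes
  that supergraph complete, hence hamiltonian.\<close>

theorem (in simple_graph) dirac:
  assumes "3 \<le> card V" "\<And>v. v \<in> V \<Longrightarrow> card V \<le> 2 * deg E v"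
  shows "has_ham_cycle V E"
proof (rule ccontr)
  assume "\<not> has_ham_cycle V E"
  then obtain F where F: "E \<subseteq> F" "maximal_nonham_graph V F"
    by (rule maximal_nonham_supergraph)
  interpret F: maximal_nonham_graph V F by fact
  have le: "deg E v \<le> deg F v" for v using F(1) by (intro F.card_le_deg) auto
  have "(u, v) \<in> F" if "u \<in> V" "v \<in> V" "u \<noteq> v" for u v
    using that assms le[of u] le[of v] by (intro F.adjacent_if_deg_sum) (fastforce dest: assms(2))+
  then show False using F.clique_has_ham_cycle F.nonham assms(1) by blast
qed

section \<open>Order 2k + 1\<close>

context simple_graph
begin

text \<open>
  No two consecutive vertices of the cycle are neighbours of \<open>z\<close>, and \<open>z\<close> has \<open>k\<close> of the \<open>2k\<close>
  vertices as neighbours, so these alternate along the cycle. The independent set consists of the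
  non-neighbours of \<open>z\<close>, including \<open>z\<close> itself.
\<close>

lemma cycle_missing_vertex:
  assumes nh: "\<not> has_ham_cycle V E" and c: "cycle_list E c" "insert z (set c) = V" "z \<notin> set c"
    and len: "length c = 2 * k" and dz: "k \<le> deg E z"
  obtains I where "I \<subseteq> V" "card I = k + 1" "\<And>u v. u \<in> I \<Longrightarrow> v \<in> I \<Longrightarrow> (u, v) \<notin> E"
proof -
  \<comment> \<open>Only what rotation preserves is recorded. Facts about the last and first vertex
    then apply to any two consecutive vertices of the cycle.\<close>
  define is_rot where
    "is_rot c' \<longleftrightarrow> cycle_list E c' \<and> set c' = set c \<and> length c' = 2 * k" for c'
  have rot: "is_rot (ys @ xs)" if "is_rot (xs @ ys)" for xs ys
    using that cycle_list_rotate by (auto simp: is_rot_def)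
  have ends: "\<not> ((z, last c') \<in> E \<and> (z, hd c') \<in> E)" if "is_rot c'" for c'
  proof
    assume "(z, last c') \<in> E \<and> (z, hd c') \<in> E"
    then have "cycle_list E (z # c')"
      using that c(3) E_sym by (auto simp: is_rot_def cycle_list_def path_list_Cons)
    then show False using nh c(2) that unfolding has_ham_cycle_def is_rot_def by fastforce
  qed
  have nbrs: "E `` {z} \<subseteq> set c'" if "is_rot c'" for c'
    using nbrs_subset[of z] c(2) that by (auto simp: is_rot_def)
  define S where "S c' = {i. i < length c' \<and> (z, c' ! i) \<in> E}" for c'
  have card_S: "card (S c') = deg E z" if "is_rot c'" for c'
    using that nbrs[OF that] card_nbr_indices[of c' z]
    by (auto simp: S_def is_rot_def cycle_list_def path_list_def)
  have S_Suc: "S c' \<inter> Suc ` S c' = {}" if "is_rot c'" for c'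
  proof (rule ccontr)
    assume "S c' \<inter> Suc ` S c' \<noteq> {}"
    then obtain i where i: "Suc i < length c'" "(z, c' ! i) \<in> E" "(z, c' ! Suc i) \<in> E"
      by (auto simp: S_def)
    have "is_rot (drop (Suc i) c' @ take (Suc i) c')" using rot that by simp
    from ends[OF this] i show False
      by (simp add: hd_drop_conv_nth take_Suc_conv_app_nth)
  qed
  have card_twice: "card (S c' \<union> Suc ` S c') = 2 * deg E z" if "is_rot c'" for c'
  proof -
    have "finite (S c')" by (simp add: S_def)
    then show ?thesis
      using S_Suc[OF that] card_S[OF that] by (simp add: card_Un_disjoint card_image)
  qed
  \<comment> \<open>If \<open>z\<close> missed both the last and the first vertex,
    \<open>S c'\<close> and its shift would be disjoint subsets of the \<open>2 * k - 1\<close>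
    positions \<open>{1..2 * k - 1}\<close>, yet have at least \<open>2 * k\<close> elements
    together.\<close>
  have alt: "(z, hd c') \<in> E" if "is_rot c'" "(z, last c') \<notin> E" for c'
  proof (rule ccontr)
    assume no: "(z, hd c') \<notin> E"
    have l: "length c' = 2 * k" "3 \<le> length c'" "c' \<noteq> []"
      using that by (auto simp: is_rot_def cycle_list_def)
    have "i \<noteq> 0 \<and> i \<noteq> 2 * k - 1" if "i \<in> S c'" for i
      using that no \<open>(z, last c') \<notin> E\<close> l
      by (intro conjI notI) (auto simp: S_def hd_conv_nth last_conv_nth)
    then have "S c' \<union> Suc ` S c' \<subseteq> {1..2 * k - 1}"
      using l by (fastforce simp: S_def)
    from card_mono[OF _ this] card_twice[OF that(1)] dz l show False by simp
  qed
  have rc: "is_rot c" using c len by (simp add: is_rot_def)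
  \<comment> \<open>An even number \<open>2 * deg E z\<close> is at most \<open>2 * k + 1\<close>,
    hence at most \<open>2 * k\<close>.\<close>
  have "S c \<union> Suc ` S c \<subseteq> {0..2 * k}" using len by (auto simp: S_def)
  from card_mono[OF _ this] have dk: "deg E z = k" using dz card_twice[OF rc] by simp
  define I where "I = V - E `` {z}"
  have indep: "(u, v) \<notin> E" if "u \<in> I" "v \<in> I" for u v
  proof
    assume uv: "(u, v) \<in> E"
    then have ne: "u \<noteq> v" "u \<noteq> z" "v \<noteq> z" using that E_sym by (auto simp: I_def)
    then have "v \<in> set c" "u \<in> set c" using that c(2) by (auto simp: I_def)
    then obtain xs ys where "c = xs @ v # ys" by (meson split_list)
    then have r: "is_rot (ys @ xs @ [v])" using rc rot[of "xs @ [v]" ys] by simp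
    then have "u \<in> set (ys @ xs)"
      using \<open>u \<in> set c\<close> ne by (auto simp: is_rot_def)
    then obtain P Q where PQ: "ys @ xs = P @ u # Q" by (meson split_list)
    \<comment> \<open>Cyclically, \<open>hd B\<close> follows \<open>u\<close> and
      \<open>hd A\<close> follows \<open>v\<close>, so \<open>alt\<close> makes both neighbours of
      \<open>z\<close>. The edge \<open>uv\<close> then closes the cycle from \<open>z\<close> along
      \<open>B\<close> to \<open>v\<close>, over to \<open>u\<close>, and back along
      \<open>A\<close>.\<close>
    define A B where "A = P @ [u]" and "B = Q @ [v]"
    have "A @ B = (ys @ xs) @ [v]" by (simp add: A_def B_def PQ)
    with r have "is_rot (A @ B)" by simp
    then have AB: "is_rot (A @ B)" "is_rot (B @ A)" using rot by auto
    have lu: "last A = u" "last B = v" "A \<noteq> []" "B \<noteq> []" by (auto simp: A_def B_def)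
    have "(z, hd A) \<in> E" "(z, hd B) \<in> E"
      using alt[OF AB(1)] alt[OF AB(2)] lu that by (auto simp: I_def)
    moreover have "path_list E (A @ B)" "z \<notin> set (A @ B)" "insert z (set (A @ B)) = V"
      "3 \<le> length (A @ B)"
      using AB(1) c(2,3) by (auto simp: is_rot_def cycle_list_def)
    ultimately have "cycle_list E (z # B @ rev A)"
      using uv lu E_sym
      by (auto simp: cycle_list_def path_list_Cons path_list_append_iff path_list_rev[OF sym_E] hd_rev last_rev)
    moreover have "set (z # B @ rev A) = V"
      using \<open>insert z (set (A @ B)) = V\<close> by auto
    ultimately show False using nh unfolding has_ham_cycle_def by blast
  qed
  have "card V = 2 * k + 1"
    using c len by (metis Suc_eq_plus1 card_insert_disjoint cycle_list_def distinct_card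
        finite_set path_list_def)
  then have "card I = k + 1"
    unfolding I_def using nbrs_subset dk by (simp add: card_Diff_subset)
  then show thesis using that[of I] indep by (auto simp: I_def)
qed

end

lemma initial_segment_eq:
  assumes "S \<subseteq> {1..n::nat}" "card S = k"
    and "\<And>i. 1 \<le> i \<Longrightarrow> Suc i \<in> S \<Longrightarrow> i \<in> S"
  shows "S = {1..k}"
proof -
  have fin: "finite S" using assms(1) finite_subset by blast
  have down: "j - i \<in> S" if "j \<in> S" "i < j" for i j
    using that
  proof (induction i)
    case (Suc i)
    then show ?case using assms(3)[of "j - Suc i"] by (simp add: Suc_diff_Suc)
  qed simp
  have "j \<le> k" if "j \<in> S" for j
  proof -
    have "{1..j} \<subseteq> S"
    proof
      fix i assume "i \<in> {1..j}"
      then show "i \<in> S" using down[OF that, of "j - i"] by simp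
    qed
    from card_mono[OF fin this] show ?thesis using assms(2) by simp
  qed
  then have "S \<subseteq> {1..k}" using assms(1) by auto
  then show ?thesis using assms(2) by (intro card_subset_eq) auto
qed

text \<open>
  Let \<open>p\<close> be a Hamiltonian path of the edge-maximal supergraph whose ends \<open>x\<close> and \<open>y\<close> are not
  adjacent. Both ends have degree \<open>k\<close>, so \<open>x\<close> is adjacent to \<open>p ! Suc i\<close> exactly if \<open>y\<close> is not
  adjacent to \<open>p ! i\<close>. If \<open>x\<close> skips \<open>p ! i\<close> and resumes at \<open>p ! Suc i\<close>, there is a cycle through
  all vertices but \<open>p ! i\<close>; otherwise the neighbours of \<open>x\<close> are \<open>p ! 1, \<dots>, p ! k\<close>, and \<open>p ! k\<close> is
  a cut vertex.
\<close>

lemma (in simple_graph) nash_williams: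
  assumes n: "card V = 2 * k + 1" and k: "2 \<le> k" and min: "\<And>v. v \<in> V \<Longrightarrow> k \<le> deg E v"
    and nh: "\<not> has_ham_cycle V E"
  shows "(\<exists>I \<subseteq> V. card I = k + 1 \<and> (\<forall>u\<in>I. \<forall>v\<in>I. (u, v) \<notin> E)) \<or>
    (\<exists>A B c. V = insert c (A \<union> B) \<and> A \<inter> B = {} \<and> c \<notin> A \<union> B \<and> card A = k \<and> card B = k \<and>
       (\<forall>a\<in>A. \<forall>b\<in>B. (a, b) \<notin> E))"
proof -
  obtain F where F: "E \<subseteq> F" "maximal_nonham_graph V F"
    using maximal_nonham_supergraph nh by blast
  interpret F: maximal_nonham_graph V F by fact
  have minF: "k \<le> deg F v" if "v \<in> V" for v
    using min[OF that] F.card_le_deg[of "E `` {v}" v] F(1) by fastforce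
  obtain x y where xy: "x \<in> V" "y \<in> V" "x \<noteq> y" "(x, y) \<notin> F"
    using F.clique_has_ham_cycle F.nonham n k by force
  then obtain p where p: "path_list F p" "set p = V" "hd p = x" "last p = y"
    using F.nonadjacent_ham_path by blast
  have V3: "3 \<le> card V" using n k by simp
  have d: "distinct p" using p by (simp add: path_list_def)
  have l: "length p = 2 * k + 1" using d p(2) n distinct_card by fastforce
  have ne: "p \<noteq> []" using l by auto
  have dsum: "deg F x + deg F y \<le> 2 * k"
    using F.ham_path_deg_sum[OF F.nonham V3 p(1,2)] p n by simp
  have dx: "deg F x = k" and dy: "deg F y = k"
    using dsum minF[OF xy(1)] minF[OF xy(2)] by linarith+
  have dich: "(x, p ! Suc i) \<in> F \<longleftrightarrow> (y, p ! i) \<notin> F" if "i < 2 * k" for i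
    using F.ham_path_dichotomy[OF F.nonham V3 p(1,2), of i] p(3,4) dx dy n that by simp
  have p0: "p ! 0 = x" "p ! (2 * k) = y" using p l ne by (auto simp: hd_conv_nth last_conv_nth)
  show ?thesis
  proof (cases "\<exists>i\<ge>1. i < 2 * k \<and> (x, p ! i) \<notin> F \<and> (x, p ! Suc i) \<in> F")
    case True
    then obtain i where i: "1 \<le> i" "i < 2 * k" "(x, p ! i) \<notin> F" "(x, p ! Suc i) \<in> F" by blast
    have y: "(y, p ! (i - 1)) \<in> F" using dich[of "i - 1"] i by simp
    define P Q where "P = take i p" and "Q = drop (Suc i) p"
    have split: "p = P @ [p ! i] @ Q" using i l by (simp add: P_def Q_def id_take_nth_drop)
    have lastP: "last P = p ! (i - 1)"
      using i(1,2) l by (cases i) (auto simp: P_def take_Suc_conv_app_nth)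
    have ends: "P \<noteq> []" "Q \<noteq> []" "hd P = x" "hd Q = p ! Suc i" "last Q = y"
      using i l p by (auto simp: P_def Q_def hd_drop_conv_nth last_drop)
    have pl: "path_list F P" "path_list F Q" "set P \<inter> set Q = {}" "p ! i \<notin> set (P @ Q)"
      using p(1) unfolding arg_cong[OF split, of "path_list F"] path_list_append_iff by auto
    have len: "length (P @ rev Q) = 2 * k" using i l by (simp add: P_def Q_def)
    \<comment> \<open>The cycle goes from \<open>x\<close> to \<open>p ! (i - 1)\<close>, jumps to
      \<open>y\<close>, returns along \<open>Q\<close> to \<open>p ! Suc i\<close> and closes at
      \<open>x\<close>.\<close>
    have c: "cycle_list F (P @ rev Q)"
      using pl ends lastP i(4) y len k F.E_sym unfolding cycle_list_def path_list_append_iff path_list_rev[OF F.sym_E]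
      by (auto simp: hd_rev last_rev)
    have setP: "insert (p ! i) (set (P @ rev Q)) = V"
      using arg_cong[OF split, of set] p(2) by auto
    have "p ! i \<in> V" using setP by blast
    then obtain I where "I \<subseteq> V" "card I = k + 1" "\<And>u v. u \<in> I \<Longrightarrow> v \<in> I \<Longrightarrow> (u, v) \<notin> F"
      using F.cycle_missing_vertex[OF F.nonham c setP _ len] pl(4) minF by auto
    moreover from this(3) have "\<forall>u\<in>I. \<forall>v\<in>I. (u, v) \<notin> E" using F(1) by blast
    ultimately show ?thesis by (intro disjI1 exI[of _ I]) simp
  next
    case False
    define S where "S = {i. i < length p \<and> (x, p ! i) \<in> F}"
    have "card S = k" using F.card_nbr_indices[OF d] F.nbrs_subset p(2) dx by (simp add: S_def)
    moreover have "S \<subseteq> {1..2 * k}"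
    proof
      fix i assume "i \<in> S"
      then show "i \<in> {1..2 * k}" using p0 l by (cases i) (auto simp: S_def)
    qed
    moreover have "i \<in> S" if "1 \<le> i" "Suc i \<in> S" for i
      using that False l by (auto simp: S_def)
    ultimately have S: "S = {1..k}" using initial_segment_eq by blast
    have xadj: "(x, p ! i) \<in> F \<longleftrightarrow> 1 \<le> i \<and> i \<le> k" if "i \<le> 2 * k" for i
    proof -
      have "i \<in> S \<longleftrightarrow> i \<in> {1..k}" using S by (rule arg_cong)
      then show ?thesis using that l by (simp add: S_def)
    qed
    have yadj: "(y, p ! i) \<in> F \<longleftrightarrow> k \<le> i" if "i < 2 * k" for i
      using dich[OF that] xadj[of "Suc i"] that by auto
    \<comment> \<open>An edge from \<open>p ! j\<close> to \<open>p ! Suc i\<close> closes a cycle with the Hamiltonian path that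
      starts at \<open>p ! j\<close>, runs back to \<open>x\<close>, and continues at \<open>p ! Suc j\<close>.\<close>
    have noedge: "(p ! j, p ! Suc i) \<notin> F" if "j < k" "k \<le> i" "i < 2 * k" for i j
    proof
      assume e: "(p ! j, p ! Suc i) \<in> F"
      define P Q where "P = take (Suc j) p" and "Q = drop (Suc j) p"
      have split: "p = P @ Q" by (simp add: P_def Q_def)
      have lens: "length P = Suc j" using l that by (simp add: P_def)
      have lastP: "last P = p ! j" using that l by (simp add: P_def take_Suc_conv_app_nth)
      have ends: "P \<noteq> []" "Q \<noteq> []" "hd P = x" "hd Q = p ! Suc j" "last Q = y"
        using that l p by (auto simp: P_def Q_def hd_drop_conv_nth last_drop)
      have "(x, p ! Suc j) \<in> F" using xadj[of "Suc j"] that by simp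
      then have w: "path_list F (rev P @ Q)"
        using p(1) ends
        unfolding arg_cong[OF split, of "path_list F"] path_list_append_iff path_list_rev[OF F.sym_E]
        by (auto simp: last_rev)
      have sw: "set (rev P @ Q) = V" using p(2) arg_cong[OF split, of set] by simp
      have nth: "(rev P @ Q) ! m = p ! m" if "j < m" "m \<le> 2 * k" for m
        using that lens l by (simp add: nth_append Q_def)
      have "(last (rev P @ Q), (rev P @ Q) ! i) \<notin> F"
      proof (rule F.ham_path_chords[OF F.nonham V3 w sw])
        show "Suc i < card V" using n that by simp
        show "(hd (rev P @ Q), (rev P @ Q) ! Suc i) \<in> F"
          using e nth[of "Suc i"] that ends lastP by (simp add: hd_rev)
      qed
      then show False using nth[of i] that ends yadj[of i] by simp
    qed
    define A B where "A = (!) p ` {..<k}" and "B = (!) p ` {k<..2 * k}"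
    have inj: "inj_on ((!) p) {..2 * k}"
      using d l by (auto simp: inj_on_def nth_eq_iff_index_eq)
    have "V = (!) p ` {..2 * k}"
      using p(2) l by (force simp: set_conv_nth)
    also have "{..2 * k} = insert k ({..<k} \<union> {k<..2 * k})" by auto
    finally have V: "V = insert (p ! k) (A \<union> B)" by (simp add: A_def B_def image_Un)
    have cards: "card A = k" "card B = k"
      using inj by (auto simp: A_def B_def intro!: card_image[THEN trans] elim: inj_on_subset)
    have disj: "A \<inter> B = {}" "p ! k \<notin> A \<union> B"
      using d l by (auto simp: A_def B_def nth_eq_iff_index_eq)
    have "(a, b) \<notin> E" if ab: "a \<in> A" "b \<in> B" for a b
    proof -
      obtain j i where "a = p ! j" "j < k" "b = p ! i" "k < i" "i \<le> 2 * k"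
        using ab by (auto simp: A_def B_def)
      then show ?thesis using noedge[of j "i - 1"] F(1) by (cases i) auto
    qed
    then show ?thesis
      using V cards disj by (intro disjI2 exI[of _ A] exI[of _ B] exI[of _ "p ! k"]) simp
  qed
qed

text \<open>In either case of \<open>nash_williams\<close> the minimum degree forces all possible
  adjacencies. Each vertex of the independent set is joined to all \<open>k\<close> vertices outside
  it, and these get degree above \<open>k\<close>, against \<open>big\<close>. With a cut vertex
  \<open>c\<close>, each vertex is joined to \<open>c\<close> and to the rest of its own
  side.\<close>

lemma (in simple_graph) nonham_order_2k1_degrees:
  assumes n: "card V = 2 * k + 1" and k: "2 \<le> k" and min: "\<And>v. v \<in> V \<Longrightarrow> k \<le> deg E v"
    and big: "card {v \<in> V. k < deg E v} \<le> k - 1" and nh: "\<not> has_ham_cycle V E"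
  obtains c where "c \<in> V" "deg E c = 2 * k" "\<And>v. v \<in> V \<Longrightarrow> v \<noteq> c \<Longrightarrow> deg E v = k"
proof -
  consider (indep) I where "I \<subseteq> V" "card I = k + 1" "\<And>u v. u \<in> I \<Longrightarrow> v \<in> I \<Longrightarrow> (u, v) \<notin> E"
    | (cut) A B c where "V = insert c (A \<union> B)" "A \<inter> B = {}" "c \<notin> A \<union> B" "card A = k" "card B = k"
        "\<And>a b. a \<in> A \<Longrightarrow> b \<in> B \<Longrightarrow> (a, b) \<notin> E"
    using nash_williams[OF n k min nh] by auto
  then show thesis
  proof cases
    case indep
    have fin: "finite (V - I)" using finite_V by simp
    have cVI: "card (V - I) = k"
      using indep(1,2) n finite_V by (simp add: card_Diff_subset finite_subset)
    have N: "E `` {u} = V - I" if "u \<in> I" for u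
    proof (rule card_seteq[OF fin])
      show "E `` {u} \<subseteq> V - I" using nbrs_subset[of u] indep(3)[OF that] by auto
      show "card (V - I) \<le> deg E u" using min[of u] that indep(1) cVI by auto
    qed
    have "k < deg E w" if "w \<in> V - I" for w
    proof -
      have "I \<subseteq> E `` {w}" using N that E_sym by blast
      then show ?thesis using card_le_deg[of I w] indep(2) by simp
    qed
    then have "V - I \<subseteq> {v \<in> V. k < deg E v}" by auto
    then have "k \<le> card {v \<in> V. k < deg E v}"
      using card_mono[of "{v \<in> V. k < deg E v}" "V - I"] finite_V cVI by simp
    then show thesis using big k by linarith
  next
    case cut
    have finA: "finite A" "finite B" using cut(1) finite_V by auto
    have side: "E `` {a} = insert c (A' - {a})"
      if "a \<in> A'" "A' = A \<and> B' = B \<or> A' = B \<and> B' = A" for a A' B'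
    proof (rule card_seteq)
      show "E `` {a} \<subseteq> insert c (A' - {a})"
        using nbrs_subset[of a] cut(1,6) that E_sym by fastforce
      have "card (insert c (A' - {a})) = k"
        using that cut(3-5) finA k by auto
      then show "card (insert c (A' - {a})) \<le> deg E a"
        using min[of a] that cut(1) by auto
    qed (use that finA in auto)
    have eA: "E `` {a} = insert c (A - {a})" if "a \<in> A" for a using side that by blast
    have eB: "E `` {b} = insert c (B - {b})" if "b \<in> B" for b using side that by blast
    have dk: "deg E v = k" if "v \<in> V" "v \<noteq> c" for v
      using that cut(1,3-5) eA eB finA k by auto
    have "A \<union> B \<subseteq> E `` {c}" using eA eB E_sym by blast
    moreover have "c \<notin> E `` {c}" by simp
    ultimately have "E `` {c} = A \<union> B" using nbrs_subset[of c] cut(1) by blast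
    then have "deg E c = 2 * k" using cut finA by (simp add: card_Un_disjoint)
    then show thesis using that[of c] cut(1) dk by blast
  qed
qed

section \<open>Order at least 2k + 2\<close>

text \<open>One vertex \<open>t\<close> of \<open>T\<close> is set aside as the passage to
  \<open>R\<close>. A Hamiltonian cycle of the remaining part \<open>W\<close> of
  \<open>S \<union> T\<close> is opened at some \<open>w\<close> in \<open>T\<close>; from the far
  end of this path one goes to \<open>t\<close>, through \<open>R\<close>, and back to
  \<open>w\<close>.\<close>

lemma (in simple_graph) clique_join_has_ham_cycle:
  assumes V: "V = S \<union> T \<union> R" "S \<inter> T = {}" "S \<inter> R = {}" "T \<inter> R = {}"
    and R: "R \<noteq> {}" and T: "2 \<le> card T" "card T < card S"
    and clique: "\<And>u v. u \<in> T \<union> R \<Longrightarrow> v \<in> T \<union> R \<Longrightarrow> u \<noteq> v \<Longrightarrow> (u, v) \<in> E"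
    and ST: "\<And>s t. s \<in> S \<Longrightarrow> t \<in> T \<Longrightarrow> (s, t) \<in> E"
    and SR: "\<And>s r. s \<in> S \<Longrightarrow> r \<in> R \<Longrightarrow> (s, r) \<notin> E"
    and degS: "\<And>s. s \<in> S \<Longrightarrow> card S \<le> deg E s"
  shows "has_ham_cycle V E"
proof -
  have fin: "finite S" "finite T" "finite R" using V(1) finite_V by auto
  obtain t where t: "t \<in> T" using T by fastforce
  define W where "W = S \<union> (T - {t})"
  define F where "F = E \<inter> W \<times> W"
  interpret F: simple_graph W F
    using fin sym_E irrefl_E
    by unfold_locales (auto simp: W_def F_def sym_def irrefl_def)
  have cT: "card (T - {t}) = card T - 1" using t fin by simp
  have cW: "card W = card S + card T - 1"
    unfolding W_def using fin V(2) cT T by (subst card_Un_disjoint) auto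
  \<comment> \<open>A vertex of \<open>S\<close> loses at most the neighbour \<open>t\<close>, and
    \<open>2 * (card S - 1)\<close> reaches \<open>card W\<close> because
    \<open>card T < card S\<close>.\<close>
  have "card W \<le> 2 * deg F v" if "v \<in> W" for v
  proof (cases "v \<in> S")
    case True
    have "E `` {v} - {t} \<subseteq> F `` {v}"
      using nbrs_subset[of v] True V(1) SR by (auto simp: F_def W_def)
    then have "card (E `` {v} - {t}) \<le> deg F v" by (rule F.card_le_deg)
    then have "card S - 1 \<le> deg F v" using degS[OF True] by (simp add: card_Diff_singleton_if split: if_splits)
    then show ?thesis using cW T by simp
  next
    case False
    have "S \<union> (T - {t} - {v}) \<subseteq> F `` {v}"
      using False that ST clique E_sym by (auto simp: F_def W_def)
    then have "card (S \<union> (T - {t} - {v})) \<le> deg F v" by (rule F.card_le_deg)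
    moreover have "card (S \<union> (T - {t} - {v})) = card S + (card T - 2)"
    proof -
      have "card (T - {t} - {v}) = card T - 2" using False that cT fin by (simp add: W_def)
      then show ?thesis using fin V(2) by (subst card_Un_disjoint) auto
    qed
    ultimately show ?thesis using cW T by simp
  qed
  then have "has_ham_cycle W F" using F.dirac cW T by simp
  then obtain ws where ws: "cycle_list F ws" "set ws = W" by (auto simp: has_ham_cycle_def)
  have "T - {t} \<noteq> {}" using cT T fin by (metis One_nat_def card.empty diff_is_0_eq not_less_eq_eq numeral_2_eq_2)
  then obtain w where w: "w \<in> T" "w \<noteq> t" by blast
  then have "w \<in> set ws" using ws by (simp add: W_def)
  then obtain as bs where "ws = as @ w # bs" by (meson split_list)
  then have "cycle_list F ((w # bs) @ as)" "set ((w # bs) @ as) = W"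
    using ws cycle_list_rotate[of F as "w # bs"] by auto
  then obtain us where us: "path_list F us" "set us = W" "hd us = w" "us \<noteq> []"
    unfolding cycle_list_def by (metis append_is_Nil_conv hd_append2 list.distinct(1) list.sel(1))
  have pus: "path_list E us" using us(1) by (rule path_list_mono) (auto simp: F_def)
  obtain rs where rs: "set rs = R" "distinct rs" using fin finite_distinct_list by blast
  then have prs: "path_list E rs" using clique by (intro clique_path_list) auto
  have rne: "rs \<noteq> []" using rs R by auto
  have in_R: "hd rs \<in> R" "last rs \<in> R" using rs rne by auto
  have "last us \<in> W" using us by auto
  then have "(last us, t) \<in> E" using ST t clique by (auto simp: W_def)
  moreover have "(t, hd rs) \<in> E" "(last rs, w) \<in> E"
    using clique t w in_R V(4) by blast+
  moreover have "t \<notin> W" "W \<inter> R = {}" "t \<notin> R" using V t by (auto simp: W_def)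
  ultimately have "path_list E (us @ t # rs)" "(last (us @ t # rs), hd (us @ t # rs)) \<in> E"
    using pus prs us rs rne by (auto simp: path_list_append_iff path_list_Cons)
  moreover have "3 \<le> length (us @ t # rs)"
  proof -
    have "0 < length us" "0 < length rs" using us rne by auto
    then show ?thesis unfolding length_append list.size by linarith
  qed
  moreover have "set (us @ t # rs) = V" using us rs t V(1) by (auto simp: W_def)
  ultimately show ?thesis unfolding has_ham_cycle_def cycle_list_def by blast
qed

lemma (in simple_graph) nonham_order_ge_2k2_degrees:
  assumes n: "2 * k + 2 \<le> card V" and k: "2 \<le> k" and S: "S \<subseteq> V" "card S = k"
    and degS: "\<And>s. s \<in> S \<Longrightarrow> deg E s = k"
    and degK: "\<And>v. v \<in> V - S \<Longrightarrow> card V - k - 1 \<le> deg E v"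
    and big: "card {v \<in> V. card V - k - 1 < deg E v} \<le> k - 1" and nh: "\<not> has_ham_cycle V E"
  obtains c where "c \<in> V" "deg E c = card V - 1"
    "\<And>v. v \<in> V - S \<Longrightarrow> v \<noteq> c \<Longrightarrow> deg E v = card V - k - 1"
proof -
  let ?n = "card V"
  obtain F where F: "E \<subseteq> F" "maximal_nonham_graph V F"
    using maximal_nonham_supergraph nh by blast
  interpret F: maximal_nonham_graph V F by fact
  have le: "deg E v \<le> deg F v" for v using F(1) by (intro F.card_le_deg) auto
  have finS: "finite S" using S finite_V finite_subset by blast
  have Sne: "S \<noteq> {}" using S k by auto
  have cK: "card (V - S) = ?n - k" using S finS by (simp add: card_Diff_subset)
  have V3: "3 \<le> ?n" using n k by simp
  note adj = F.adjacent_if_deg_sum[OF _ _ _ _ V3]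
  have degK': "?n - k - 1 \<le> deg F v" if "v \<in> V - S" for v
    using degK[OF that] le[of v] by linarith
  have degS': "k \<le> deg F s" if "s \<in> S" for s
    using degS[OF that] le[of s] by linarith
  \<comment> \<open>Here \<open>2 * (?n - k - 1)\<close> is at least \<open>?n\<close> because
    \<open>?n\<close> is at least \<open>2 * k + 2\<close>.\<close>
  have clique: "(u, v) \<in> F" if "u \<in> V - S" "v \<in> V - S" "u \<noteq> v" for u v
    using that degK'[of u] degK'[of v] n by (intro adj) auto
  define T where "T = {v \<in> V - S. \<exists>s\<in>S. (v, s) \<in> F}"
  define R where "R = V - S - T"
  have finT: "finite T" "finite R" using finite_V by (auto simp: T_def R_def)
  \<comment> \<open>One neighbour \<open>s'\<close> in \<open>S\<close> raises the degree of
    \<open>v\<close> to \<open>?n - k\<close>, just enough for adjacency to every vertex of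
    \<open>S\<close>.\<close>
  have ST: "(s, v) \<in> F" if st: "s \<in> S" "v \<in> T" for s v
  proof (rule adj)
    obtain s' where s': "s' \<in> S" "(v, s') \<in> F" using st(2) by (auto simp: T_def)
    then have "insert s' (V - S - {v}) \<subseteq> F `` {v}" using clique that by (auto simp: T_def)
    then have "card (insert s' (V - S - {v})) \<le> deg F v" by (rule F.card_le_deg)
    moreover have "card (insert s' (V - S - {v})) = ?n - k"
      using s' that cK finite_V n by (simp add: T_def)
    ultimately show "?n \<le> deg F s + deg F v" using degS'[OF that(1)] n by linarith
  qed (use that S in \<open>auto simp: T_def\<close>)
  have SR: "(s, r) \<notin> F" if "s \<in> S" "r \<in> R" for s r
    using that F.E_sym by (auto simp: R_def T_def)
  \<comment> \<open>Degree \<open>k + 1\<close> at one vertex of \<open>S\<close> would join it to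
    all of \<open>V - S\<close>. Then \<open>R\<close> is empty, every vertex of \<open>S\<close> is
    joined to all of \<open>V - S\<close>, and \<open>F\<close> is complete.\<close>
  have degF: "deg F s = k" if s: "s \<in> S" for s
  proof (rule ccontr)
    assume "deg F s \<noteq> k"
    then have "k + 1 \<le> deg F s" using degS'[OF s] by simp
    then have "(s, v) \<in> F" if "v \<in> V - S" for v
      using that s S degK'[OF that] n by (intro adj) auto
    then have "R = {}" using SR s by (auto simp: R_def)
    then have T: "T = V - S" by (auto simp: R_def T_def)
    have large: "?n - k \<le> deg F s'" if "s' \<in> S" for s'
      using F.card_le_deg[of "V - S" s'] ST[OF that] T cK by auto
    have "(u, v) \<in> F" if "u \<in> V" "v \<in> V" "u \<noteq> v" for u v
    proof (cases "u \<in> S \<and> v \<in> S")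
      case True
      then show ?thesis using large[of u] large[of v] that n by (intro adj) auto
    next
      case False
      then show ?thesis using that T ST clique F.E_sym by blast
    qed
    then show False using F.clique_has_ham_cycle[OF V3] F.nonham by blast
  qed
  have nbrs_S: "E `` {s} = F `` {s}" if "s \<in> S" for s
    using degF[OF that] degS[OF that] F(1) by (intro card_subset_eq) auto
  have tk: "card T \<le> k"
  proof -
    obtain s where "s \<in> S" using Sne by blast
    then show ?thesis using F.card_le_deg[of T s] ST degF by fastforce
  qed
  have cR: "card R = ?n - k - card T"
    unfolding R_def using finT(1) cK by (subst card_Diff_subset) (auto simp: T_def)
  have Rne: "R \<noteq> {}" using cR tk n by auto
  \<comment> \<open>A vertex of \<open>R\<close> has no neighbour in \<open>S\<close>, which leaves
    only \<open>?n - k - 1\<close> candidates, all of them required by its degree in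
    \<open>E\<close>.\<close>
  have nbrs_R: "E `` {r} = V - S - {r}" if "r \<in> R" for r
  proof (rule card_seteq)
    show "E `` {r} \<subseteq> V - S - {r}"
      using nbrs_subset[of r] SR that F(1) E_sym by fastforce
    have "card (V - S - {r}) = ?n - k - 1" using that cK by (simp add: R_def)
    then show "card (V - S - {r}) \<le> deg E r" using degK[of r] that by (simp add: R_def)
  qed (use finite_V in simp)
  \<comment> \<open>The edges of \<open>F\<close> between \<open>T\<close> and
    \<open>S \<union> R\<close> are already in \<open>E\<close>, as seen from their ends in
    \<open>S\<close> and \<open>R\<close>.\<close>
  have nbrs_T: "S \<union> R \<subseteq> E `` {v}" if "v \<in> T" for v
  proof -
    have "(s, v) \<in> E" if "s \<in> S" for s using nbrs_S[OF that] ST[OF that \<open>v \<in> T\<close>] by blast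
    moreover have "(r, v) \<in> E" if "r \<in> R" for r
      using nbrs_R[OF that] \<open>v \<in> T\<close> that by (auto simp: R_def T_def)
    ultimately show ?thesis using E_sym by blast
  qed
  have cSR: "card (S \<union> R) = ?n - card T"
  proof -
    have "S \<union> R = V - T" using S by (auto simp: R_def T_def)
    then show ?thesis using finT by (simp add: card_Diff_subset T_def subset_iff)
  qed
  consider "card T = 0" | "card T = 1" | "2 \<le> card T" "card T < k" | "card T = k"
    using tk by linarith
  then show thesis
  proof cases
    \<comment> \<open>With \<open>T\<close> empty, a vertex of \<open>S\<close> has only the other
      \<open>k - 1\<close> vertices of \<open>S\<close> as possible neighbours.\<close>
    case 1
    obtain s where s: "s \<in> S" using Sne by blast
    have "E `` {s} \<subseteq> S - {s}"
      using nbrs_S[OF s] F.nbrs_subset[of s] SR[OF s] 1 finT by (auto simp: R_def)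
    then have "deg E s \<le> card (S - {s})" using finS by (intro deg_le_card) auto
    then show thesis using degS[OF s] S s k finS by simp
  next
    case 2
    then obtain c where c: "T = {c}" by (auto simp: card_1_singleton_iff)
    then have cV: "c \<in> V" by (auto simp: T_def)
    have "deg E c = ?n - 1"
    proof (rule antisym)
      have "E `` {c} \<subseteq> V - {c}" using nbrs_subset[of c] by auto
      then have "deg E c \<le> card (V - {c})" using finite_V by (intro deg_le_card) auto
      then show "deg E c \<le> ?n - 1" using cV by simp
      show "?n - 1 \<le> deg E c" using card_le_deg[OF nbrs_T[of c]] c cSR by simp
    qed
    moreover have "deg E v = ?n - k - 1" if "v \<in> V - S" "v \<noteq> c" for v
      using nbrs_R[of v] that c cK by (simp add: R_def)
    ultimately show thesis using that[OF cV] by blast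
  next
    case 3
    have "has_ham_cycle V F"
    proof (rule F.clique_join_has_ham_cycle)
      show "V = S \<union> T \<union> R" using S by (auto simp: R_def T_def)
      show "S \<inter> T = {}" "S \<inter> R = {}" "T \<inter> R = {}" by (auto simp: R_def T_def)
      show "(u, v) \<in> F" if "u \<in> T \<union> R" "v \<in> T \<union> R" "u \<noteq> v" for u v
        using that by (intro clique) (auto simp: R_def T_def)
      show "card S \<le> deg F s" if "s \<in> S" for s using degF[OF that] S(2) by simp
    qed (fact Rne ST SR | use 3 S in simp)+
    then show thesis using F.nonham by simp
  next
    case 4
    have "T \<subseteq> {v \<in> V. ?n - k - 1 < deg E v}"
    proof
      fix v assume v: "v \<in> T"
      have "?n - k \<le> deg E v" using card_le_deg[OF nbrs_T[OF v]] cSR 4 by simp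
      then show "v \<in> {v \<in> V. ?n - k - 1 < deg E v}" using v n by (auto simp: T_def)
    qed
    then have "card T \<le> card {v \<in> V. ?n - k - 1 < deg E v}"
      using finite_V by (intro card_mono) auto
    then show thesis using 4 big k by linarith
  qed
qed

section \<open>Transfer to pair graphs, and the degree sequence\<close>

lemma has_ham_cycle_imp_hamiltonian:
  assumes "has_ham_cycle (pverts G) (parcs G)"
  shows "hamiltonian G"
proof -
  obtain xs where xs: "cycle_list (parcs G) xs" "set xs = pverts G"
    using assms by (auto simp: has_ham_cycle_def)
  have ne: "xs \<noteq> []" and len: "3 \<le> length xs" and d: "distinct xs"
    using xs(1) by (auto simp: cycle_list_def path_list_def)
  define p where "p = zip xs (tl xs @ [hd xs])"
  have lenp: "length p = length xs" using ne by (simp add: p_def)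
  \<comment> \<open>The end \<open>w\<close> is arbitrary because the induction removes the head, to
    which the closing arc returns. The start \<open>u\<close> affects \<open>pawalk_verts\<close>
    only for the empty walk.\<close>
  have walk: "pcas (hd ys) (zip ys (tl ys @ [w])) w \<and> pawalk_verts u (zip ys (tl ys @ [w])) = ys @ [w]
      \<and> (path_list E ys \<longrightarrow> (last ys, w) \<in> E \<longrightarrow> set (zip ys (tl ys @ [w])) \<subseteq> E)"
    if "ys \<noteq> []" for ys u and w :: 'a and E
    using that
  proof (induction ys arbitrary: u)
    case (Cons y ys)
    show ?case
    proof (cases ys)
      case (Cons z zs)
      then show ?thesis using Cons.IH[of z] by (auto simp: path_list_Cons)
    qed simp
  qed simp
  have "set p \<subseteq> parcs G"
    using walk[OF ne, of "hd xs" undefined "parcs G"] xs(1) by (auto simp: p_def cycle_list_def)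
  moreover have "pcas (hd xs) p (hd xs)" "pawalk_verts (hd xs) p = xs @ [hd xs]"
    using walk[OF ne, of "hd xs" "hd xs"] by (auto simp: p_def)
  moreover have "distinct (tl xs @ [hd xs])" using d ne by (cases xs) auto
  ultimately have "pre_digraph.cycle (with_proj G) p"
    using ne lenp xs(2)
    by (auto simp: pre_digraph.cycle_def pre_digraph.awalk_def cas_with_proj_eq
        awalk_verts_with_proj_eq intro!: exI[of _ "hd xs"])
  moreover have "fst ` set p = pverts G"
    using xs(2) lenp ne by (simp add: p_def flip: set_map)
  ultimately show ?thesis using len lenp unfolding hamiltonian_def by auto
qed

lemma out_degree_eq_deg: "out_degree (with_proj G) v = deg (parcs G) v"
proof -
  have "out_arcs (with_proj G) v = Pair v ` (parcs G `` {v})"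
    by (auto simp: out_arcs_def)
  then show ?thesis by (simp add: out_degree_def card_image inj_on_def)
qed

lemma pair_graph_imp_simple_graph:
  assumes "pair_graph G"
  shows "simple_graph (pverts G) (parcs G)"
proof -
  interpret pair_graph G by fact
  show ?thesis
  proof
    show "parcs G \<subseteq> pverts G \<times> pverts G" using wellformed' by auto
    show "sym (parcs G)" using pair_sym_arcs by (simp add: symmetric_def)
    show "irrefl (parcs G)" using pair_no_loops by (force simp: irrefl_def)
  qed (rule pair_finite_verts)
qed

theorem theorem2p3:
  fixes n k :: nat and d :: "nat \<Rightarrow> nat"
  assumes "n \<ge> 5" and "k \<ge> 2" and "real k < real n / 2"
    and "mono_on {1..n} d"
    and "graphical n d"
    and "\<forall>j\<in>{1..k}. d j = k"
    and "\<forall>j\<in>{k+1..n-k+1}. d j = n - k - 1"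
    and "\<not> ((\<forall>j\<in>{n-k+2..n-1}. d j = n - k - 1) \<and> d n = n - 1)"
  shows "forcibly_hamiltonian TYPE('a) n d"
proof -
  have kn: "2 * k < n" using assms(3) by simp
  have "hamiltonian G" if G: "pair_graph G" "has_degree_sequence G n d"
    for G :: "'a pair_pre_digraph"
  proof (rule ccontr)
    assume "\<not> hamiltonian G"
    define V E where "V = pverts G" and "E = parcs G"
    interpret simple_graph V E unfolding V_def E_def by (rule pair_graph_imp_simple_graph[OF G(1)])
    have nh: "\<not> has_ham_cycle V E"
      using \<open>\<not> hamiltonian G\<close> has_ham_cycle_imp_hamiltonian by (auto simp: V_def E_def)
    obtain v where v: "bij_betw v {1..n} V" and dv: "\<And>i. i \<in> {1..n} \<Longrightarrow> deg E (v i) = d i"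
      using G(2) by (auto simp: has_degree_sequence_def out_degree_eq_deg V_def E_def)
    have cV: "card V = n" using bij_betw_same_card[OF v] by simp
    have Vimg: "V = v ` {1..n}" and inj: "inj_on v {1..n}"
      using v by (auto simp: bij_betw_def)
    \<comment> \<open>\<open>S\<close> is chosen by index, not by degree: if
      \<open>n = 2 * k + 1\<close>, further vertices have degree \<open>k\<close>.\<close>
    define S where "S = v ` {1..k}"
    have S: "S \<subseteq> V" "card S = k"
      using kn inj Vimg by (auto simp: S_def card_image inj_on_subset)
    have degS: "deg E s = k" if "s \<in> S" for s
      using that assms(6) dv kn by (auto simp: S_def)
    have dge: "n - k - 1 \<le> d i" if "i \<in> {k<..n}" for i
    proof -
      have "d (k + 1) \<le> d i" using that by (intro mono_onD[OF assms(4)]) auto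
      then show ?thesis using assms(7) kn by simp
    qed
    have VS: "\<exists>i\<in>{k<..n}. u = v i" if "u \<in> V - S" for u
      using that by (force simp: Vimg S_def)
    have degK: "n - k - 1 \<le> deg E u" if "u \<in> V - S" for u
      using VS[OF that] dge dv by auto
    have big: "card {u \<in> V. n - k - 1 < deg E u} \<le> k - 1"
    proof -
      have "{u \<in> V. n - k - 1 < deg E u} \<subseteq> v ` {n - k + 2..n}"
      proof
        fix u assume u: "u \<in> {u \<in> V. n - k - 1 < deg E u}"
        then obtain i where i: "i \<in> {1..n}" "u = v i" using Vimg by auto
        then have "n - k - 1 < d i" using u dv by auto
        then have "i \<notin> {1..k}" "i \<notin> {k+1..n-k+1}" using assms(6,7) kn by auto
        then show "u \<in> v ` {n - k + 2..n}" using i by auto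
      qed
      then have "card {u \<in> V. n - k - 1 < deg E u} \<le> card (v ` {n - k + 2..n})"
        by (intro card_mono) auto
      also have "\<dots> \<le> card {n - k + 2..n}" by (rule card_image_le) simp
      also have "\<dots> = k - 1" using kn by simp
      finally show ?thesis .
    qed
    \<comment> \<open>Both orders give the same conclusion, since \<open>n - k - 1 = k\<close> if
      \<open>n = 2 * k + 1\<close>.\<close>
    obtain c where c: "c \<in> V" "deg E c = n - 1"
      "\<And>u. u \<in> V - S \<Longrightarrow> u \<noteq> c \<Longrightarrow> deg E u = n - k - 1"
    proof (cases "n = 2 * k + 1")
      case True
      have "k \<le> deg E u" if "u \<in> V" for u
        using degS degK that True by (cases "u \<in> S") auto
      then obtain c where "c \<in> V" "deg E c = 2 * k" "\<And>u. u \<in> V \<Longrightarrow> u \<noteq> c \<Longrightarrow> deg E u = k"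
        using nonham_order_2k1_degrees[of k] True cV assms(2) big nh by auto
      then show thesis using that[of c] True by simp
    next
      case False
      then show thesis
        using nonham_order_ge_2k2_degrees[of k S thesis] cV kn assms(2) S degS degK big nh that by auto
    qed
    obtain j where j: "j \<in> {1..n}" "c = v j" using c(1) Vimg by auto
    have other: "d i = n - k - 1" if "i \<in> {k<..n}" "i \<noteq> j" for i
    proof -
      have "v i \<in> V - S" "v i \<noteq> c"
        using that j inj Vimg kn inj_on_image_mem_iff[OF inj, of i "{1..k}"]
          inj_on_eq_iff[OF inj, of i j] by (auto simp: S_def)
      then show ?thesis using c(3) dv[of i] that by auto
    qed
    have dj: "d j = n - 1" using dv[OF j(1)] c(2) j(2) by simp
    \<comment> \<open>Monotonicity puts the exceptional degree \<open>n - 1\<close> last; otherwise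
      \<open>d n\<close> would be \<open>n - k - 1\<close>, below \<open>d j\<close>.\<close>
    have "j = n"
    proof (rule ccontr)
      assume "j \<noteq> n"
      then have "d n = n - k - 1" using other[of n] kn by simp
      moreover have "d j \<le> d n" using j(1) by (intro mono_onD[OF assms(4)]) auto
      ultimately show False using dj kn assms(2) by simp
    qed
    have "d i = n - k - 1" if "i \<in> {n-k+2..n-1}" for i
      using that \<open>j = n\<close> kn by (intro other) auto
    then show False using assms(8) dj \<open>j = n\<close> by blast
  qed
  then show ?thesis using assms(5) by (simp add: forcibly_hamiltonian_def)
qed

end
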